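(* Let $N\ge1$ and let $p_N(x)$ be an Ulam polynomial of degree $N$ with coefficients (which are also the zeros) $\gamma=(\gamma_1,\dots,\gamma_N)\in\mathbb C^N$, that is, $p_N(x)=x^N+\sum_{m=1}^N\gamma_mx^{N-m}=\prod_{n=1}^N(x-\gamma_n)$. Then for all integers $n$ with $1\le n\le N$ the following identities hold: $$\gamma_n^N+\sum_{m=1}^N\gamma_m\gamma_n^{N-m}=0,$$ $$N\gamma_n^{N-1}+\sum_{m=1}^{N-1}(N-m)\gamma_m\gamma_n^{N-m-1}=\prod_{m=1,\,m\ne n}^N(\gamma_n-\gamma_m),$$ $$N(N-1)\gamma_n^{N-2}+\sum_{m=1}^{N-2}(N-m)(N-m-1)\gamma_m\gamma_n^{N-m-2}=2\sum_{m=1,\,m\ne n}^N\ \prod_{k=1,\,k\ne n,m}^N(\gamma_n-\gamma_k),$$ $$\gamma_n^N+\sum_{m=1}^N(-1)^ms_m^{(N)}(\gamma)\gamma_n^{N-m}=0.$$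
   Context: $s_m^{(N)}(\gamma)$ denotes the $m$-th elementary symmetric polynomial evaluated at $(\gamma_1,\dots,\gamma_N)$. Conventions: $\gamma_n^0=1$ (also when $\gamma_n=0$), empty sums are $0$, empty products are $1$, and for $N=1$ the term $N(N-1)\gamma_n^{N-2}$ is understood to be $0$. *)

theory Defs
  imports Complex_Main "HOL-Computational_Algebra.Polynomial"
begin

text \<open>
  A point of \<open>\<complex>\<^sup>N\<close> is represented by a function \<open>\<gamma> :: nat \<Rightarrow> complex\<close> of which only the values
  at \<open>1, \<dots>, N\<close> are used.
\<close>

definition elem_sym :: "nat \<Rightarrow> (nat \<Rightarrow> complex) \<Rightarrow> nat \<Rightarrow> complex" where
  "elem_sym N \<gamma> m = (\<Sum>A | A \<subseteq> {1..N} \<and> card A = m. \<Prod>i\<in>A. \<gamma> i)"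

text \<open>
  The zeros are counted with multiplicity: the components of \<open>\<gamma>\<close> need not be distinct or nonzero.
\<close>

definition ulam_polynomial :: "nat \<Rightarrow> (nat \<Rightarrow> complex) \<Rightarrow> complex poly \<Rightarrow> bool" where
  "ulam_polynomial N \<gamma> p \<longleftrightarrow>
     p = monom 1 N + (\<Sum>m=1..N. monom (\<gamma> m) (N - m)) \<and>
     p = (\<Prod>n=1..N. [:- \<gamma> n, 1:])"

end

theory Submission
  imports Defs
begin

text \<open>Evaluate \<open>p\<close> and its first two derivatives at the zero
  \<open>\<gamma> n\<close> in two ways. The coefficient form gives the left-hand sides of the first
  three identities. The factorisation \<open>p = (x - \<gamma> n) * q\<close>, with \<open>q\<close>
  the product over the other indices, gives \<open>p = 0\<close>, \<open>p' = q\<close> and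
  \<open>p'' = 2 q'\<close> there (\<open>poly_pderiv_linear_mult_root\<close>). The fourth identity
  is Vieta's expansion of the product of all \<open>x - \<gamma> i\<close>
  (\<open>prod_diff_elem_sym\<close>) at \<open>x = \<gamma> n\<close>.\<close>

text \<open>Multiplying out chooses the subset \<open>A\<close> of factors that contribute
  \<open>- \<gamma> i\<close>; grouping the subsets by cardinality \<open>m\<close> yields the sign,
  the elementary symmetric polynomial and the power of \<open>x\<close>.\<close>

lemma prod_diff_elem_sym:
  "(\<Prod>i=1..N. x - \<gamma> i) = x ^ N + (\<Sum>m=1..N. (-1) ^ m * elem_sym N \<gamma> m * x ^ (N - m))"
proof -
  have "(\<Prod>i=1..N. x - \<gamma> i) = (\<Prod>i=1..N. - \<gamma> i + x)"
    by simp
  also have "\<dots> = (\<Sum>A\<in>Pow {1..N}. (\<Prod>i\<in>A. - \<gamma> i) * (\<Prod>i\<in>{1..N} - A. x))"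
    by (rule prod_add) simp
  also have "\<dots> = (\<Sum>m\<in>{0..N}. \<Sum>A | A \<in> Pow {1..N} \<and> card A = m.
      (\<Prod>i\<in>A. - \<gamma> i) * (\<Prod>i\<in>{1..N} - A. x))"
    by (rule sum.group[symmetric]) (auto dest: card_mono[rotated])
  also have "\<dots> = (\<Sum>m\<in>{0..N}. (-1) ^ m * elem_sym N \<gamma> m * x ^ (N - m))"
    unfolding elem_sym_def sum_distrib_left sum_distrib_right
    by (intro sum.cong)
      (auto simp: prod_uminus card_Diff_subset finite_subset)
  also have "\<dots> = x ^ N + (\<Sum>m=1..N. (-1) ^ m * elem_sym N \<gamma> m * x ^ (N - m))"
  proof -
    \<comment> \<open>This makes the term \<open>m = 0\<close> equal to \<open>x ^ N\<close>.
      Finiteness matters because \<open>card\<close> is also 0 on infinite sets.\<close>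
    have "{A. A \<subseteq> {1..N} \<and> card A = 0} = {{}}"
      using finite_subset[of _ "{1..N}"] by auto
    then show ?thesis
      by (simp add: sum.atLeast_Suc_atMost elem_sym_def)
  qed
  finally show ?thesis .
qed

text \<open>By Leibniz the derivatives are \<open>q + (x - a) q'\<close> and
  \<open>2 q' + (x - a) q''\<close>, and the terms with \<open>x - a\<close> vanish at
  \<open>a\<close>.\<close>

lemma poly_pderiv_linear_mult_root:
  fixes q :: "'a::idom poly"
  shows "poly (pderiv ([:- a, 1:] * q)) a = poly q a"
    and "poly (pderiv (pderiv ([:- a, 1:] * q))) a = 2 * poly (pderiv q) a"
  by (simp_all add: pderiv_mult pderiv_add pderiv_pCons del: mult_pCons_left)

theorem proposition2p2:
  fixes N :: nat and \<gamma> :: "nat \<Rightarrow> complex" and p :: "complex poly"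
  assumes "N \<ge> 1"
    and "ulam_polynomial N \<gamma> p"
  shows "\<forall>n\<in>{1..N}.
      \<gamma> n ^ N + (\<Sum>m=1..N. \<gamma> m * \<gamma> n ^ (N - m)) = 0 \<and>
      of_nat N * \<gamma> n ^ (N - 1) + (\<Sum>m=1..N-1. of_nat (N - m) * \<gamma> m * \<gamma> n ^ (N - m - 1))
        = (\<Prod>m\<in>{1..N} - {n}. \<gamma> n - \<gamma> m) \<and>
      of_nat (N * (N - 1)) * \<gamma> n ^ (N - 2)
          + (\<Sum>m=1..N-2. of_nat ((N - m) * (N - m - 1)) * \<gamma> m * \<gamma> n ^ (N - m - 2))
        = 2 * (\<Sum>m\<in>{1..N} - {n}. \<Prod>k\<in>{1..N} - {n, m}. \<gamma> n - \<gamma> k) \<and>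
      \<gamma> n ^ N + (\<Sum>m=1..N. (-1) ^ m * elem_sym N \<gamma> m * \<gamma> n ^ (N - m)) = 0"
proof (intro ballI conjI)
  fix n assume n: "n \<in> {1..N}"
  define q where "q = (\<Prod>m\<in>{1..N} - {n}. [:- \<gamma> m, 1:])"
  have coeffs: "p = monom 1 N + (\<Sum>m=1..N. monom (\<gamma> m) (N - m))"
    and roots: "p = (\<Prod>n=1..N. [:- \<gamma> n, 1:])"
    using assms(2) by (auto simp: ulam_polynomial_def)
  \<comment> \<open>The factor is removed by its index, not by its value, so repeated zeros need no
    separate treatment.\<close>
  have factor: "p = [:- \<gamma> n, 1:] * q"
    unfolding roots q_def using n by (intro prod.remove) auto
  have p_coeffs: "poly p x = x ^ N + (\<Sum>m=1..N. \<gamma> m * x ^ (N - m))" for x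
    unfolding coeffs by (simp add: poly_sum poly_monom)
  have p'_coeffs: "poly (pderiv p) x =
      of_nat N * x ^ (N - 1) + (\<Sum>m=1..N. of_nat (N - m) * \<gamma> m * x ^ (N - m - 1))" for x
    unfolding coeffs by (simp add: pderiv_add higher_pderiv_sum[of "Suc 0", simplified] pderiv_monom poly_sum poly_monom)
  have p''_coeffs: "poly (pderiv (pderiv p)) x = of_nat (N * (N - 1)) * x ^ (N - 2)
      + (\<Sum>m=1..N. of_nat ((N - m) * (N - m - 1)) * \<gamma> m * x ^ (N - m - 2))" for x
    unfolding coeffs
    by (simp add: pderiv_add higher_pderiv_sum[of "Suc 0", simplified] pderiv_monom poly_sum poly_monom mult_ac numeral_2_eq_2)
  have p_root: "poly p (\<gamma> n) = 0"
    by (simp add: factor)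
  show "\<gamma> n ^ N + (\<Sum>m=1..N. \<gamma> m * \<gamma> n ^ (N - m)) = 0"
    using p_root p_coeffs by simp
  \<comment> \<open>Read backwards, the expansion is a product whose factor \<open>i = n\<close> is
    zero.\<close>
  show "\<gamma> n ^ N + (\<Sum>m=1..N. (-1) ^ m * elem_sym N \<gamma> m * \<gamma> n ^ (N - m)) = 0"
    unfolding prod_diff_elem_sym[symmetric] using n by auto
  \<comment> \<open>The extra term \<open>m = N\<close>, the derivative of the constant coefficient,
    has factor \<open>of_nat 0\<close>.\<close>
  have "(\<Sum>m=1..N-1. of_nat (N - m) * \<gamma> m * \<gamma> n ^ (N - m - 1))
      = (\<Sum>m=1..N. of_nat (N - m) * \<gamma> m * \<gamma> n ^ (N - m - 1))"
    by (rule sum.mono_neutral_left) auto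
  then have "of_nat N * \<gamma> n ^ (N - 1) + (\<Sum>m=1..N-1. of_nat (N - m) * \<gamma> m * \<gamma> n ^ (N - m - 1))
      = poly (pderiv p) (\<gamma> n)"
    by (simp only: p'_coeffs)
  also have "\<dots> = poly q (\<gamma> n)"
    unfolding factor by (rule poly_pderiv_linear_mult_root)
  also have "\<dots> = (\<Prod>m\<in>{1..N} - {n}. \<gamma> n - \<gamma> m)"
    by (simp add: q_def poly_prod)
  finally show "of_nat N * \<gamma> n ^ (N - 1)
      + (\<Sum>m=1..N-1. of_nat (N - m) * \<gamma> m * \<gamma> n ^ (N - m - 1))
      = (\<Prod>m\<in>{1..N} - {n}. \<gamma> n - \<gamma> m)" .
  \<comment> \<open>For \<open>m > N - 2\<close> one of the factors \<open>N - m\<close> and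
    \<open>N - m - 1\<close> is 0 in truncated subtraction; this also covers
    \<open>N = 1\<close>.\<close>
  have "(\<Sum>m=1..N-2. of_nat ((N - m) * (N - m - 1)) * \<gamma> m * \<gamma> n ^ (N - m - 2))
      = (\<Sum>m=1..N. of_nat ((N - m) * (N - m - 1)) * \<gamma> m * \<gamma> n ^ (N - m - 2))"
    by (rule sum.mono_neutral_left) auto
  then have "of_nat (N * (N - 1)) * \<gamma> n ^ (N - 2)
      + (\<Sum>m=1..N-2. of_nat ((N - m) * (N - m - 1)) * \<gamma> m * \<gamma> n ^ (N - m - 2))
      = poly (pderiv (pderiv p)) (\<gamma> n)"
    by (simp only: p''_coeffs)
  also have "\<dots> = 2 * poly (pderiv q) (\<gamma> n)"
    unfolding factor by (rule poly_pderiv_linear_mult_root)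
  also have "poly (pderiv q) (\<gamma> n)
      = (\<Sum>m\<in>{1..N} - {n}. \<Prod>k\<in>{1..N} - {n, m}. \<gamma> n - \<gamma> k)"
    \<comment> \<open>Each linear factor has derivative 1, so the product rule just omits one index;
      the flipped rule merges the two removals into \<open>{n, m}\<close>.\<close>
    by (simp add: q_def pderiv_prod pderiv_pCons poly_sum poly_prod flip: Diff_insert2)
  finally show "of_nat (N * (N - 1)) * \<gamma> n ^ (N - 2)
      + (\<Sum>m=1..N-2. of_nat ((N - m) * (N - m - 1)) * \<gamma> m * \<gamma> n ^ (N - m - 2))
      = 2 * (\<Sum>m\<in>{1..N} - {n}. \<Prod>k\<in>{1..N} - {n, m}. \<gamma> n - \<gamma> k)" .
qed

end
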